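(* Let $\gamma\in(0,1]$, $\lambda>0$ and $c>0$. For $a>0$ small enough that $\kappa=1-ac\in[0,1)$, let $X$ be an $\mathrm{SDS}(\gamma,\lambda,\kappa)$ random variable with $\kappa=1-ac$, let $X^a=aX$, and let $f^a$ be the characteristic function of $X^a$, that is, $$f^a(t)=\exp\left\{-\lambda\left(1-(1-\kappa)\frac{\cos(at)-\kappa}{\kappa^2-2\kappa\cos(at)+1}\right)^{\gamma}\right\}.$$ Then for every $t\in\mathbb{R}$ $$f^a(t)\longrightarrow\varphi(t)=\exp\left\{-\lambda\left(\frac{t^2}{t^2+c^2}\right)^{\gamma}\right\}\qquad\text{as }a\to0.$$
   Context: For $\gamma\in(0,1]$, $\lambda>0$, $\kappa\in[0,1)$, $\mathrm{SDS}(\gamma,\lambda,\kappa)$ denotes the distribution on $\mathbb{Z}$ with characteristic function $$f(t)=\exp\left\{-\lambda\left(1-(1-\kappa)\frac{\cos t-\kappa}{\kappa^2-2\kappa\cos t+1}\right)^{\gamma}\right\}.$$ The limit is over $a\downarrow0$. *)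

theory Defs
  imports "HOL-Probability.Probability"
begin

text \<open>The base of the real power is nonnegative, and it vanishes when \<open>cos t = 1\<close>; since
  \<open>\<gamma> > 0\<close>, the library convention \<open>0 powr \<gamma> = 0\<close> agrees with the usual value there.\<close>

definition SDS_cf :: "real \<Rightarrow> real \<Rightarrow> real \<Rightarrow> real \<Rightarrow> real" where
  "SDS_cf \<gamma> lam \<kappa> t =
     exp (- lam * (1 - (1 - \<kappa>) * ((cos t - \<kappa>) / (\<kappa>\<^sup>2 - 2 * \<kappa> * cos t + 1))) powr \<gamma>)"

text \<open>A distribution on the integers is determined by its characteristic function, so at most one
  \<open>p\<close> satisfies the following predicate.\<close>

definition is_SDS :: "real \<Rightarrow> real \<Rightarrow> real \<Rightarrow> int pmf \<Rightarrow> bool" where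
  "is_SDS \<gamma> lam \<kappa> p \<longleftrightarrow>
     0 < \<gamma> \<and> \<gamma> \<le> 1 \<and> 0 < lam \<and> 0 \<le> \<kappa> \<and> \<kappa> < 1 \<and>
     (\<forall>t. char (distr (measure_pmf p) borel real_of_int) t = complex_of_real (SDS_cf \<gamma> lam \<kappa> t))"

definition SDS_random_variable ::
    "real \<Rightarrow> real \<Rightarrow> real \<Rightarrow> 'a measure \<Rightarrow> ('a \<Rightarrow> int) \<Rightarrow> bool" where
  "SDS_random_variable \<gamma> lam \<kappa> M X \<longleftrightarrow>
     prob_space M \<and> X \<in> measurable M (count_space UNIV) \<and>
     (\<exists>p. is_SDS \<gamma> lam \<kappa> p \<and> distr M (count_space UNIV) X = measure_pmf p)"

text \<open>The characteristic function of \<open>a * X\<close>.\<close>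

definition scaled_cf :: "'a measure \<Rightarrow> ('a \<Rightarrow> int) \<Rightarrow> real \<Rightarrow> real \<Rightarrow> complex" where
  "scaled_cf M X a = char (distr M borel (\<lambda>\<omega>. a * real_of_int (X \<omega>)))"

end

theory Submission
  imports Defs
begin

text \<open>Write \<open>\<kappa> = 1 - a * c\<close> and \<open>C = cos (a * t)\<close>. The denominator in the characteristic function
  is \<open>(1 - \<kappa>)\<^sup>2 + 2 * \<kappa> * (1 - C)\<close>, and putting everything over it collapses the base of the power to
  \<open>(1 + \<kappa>) * (1 - C) / ((1 - \<kappa>)\<^sup>2 + 2 * \<kappa> * (1 - C))\<close> (\<open>SDS_base_eq\<close>). Now both \<open>1 - C\<close> and
  \<open>(1 - \<kappa>)\<^sup>2 = a\<^sup>2 * c\<^sup>2\<close> are of order \<open>a\<^sup>2\<close>. After division by \<open>a\<^sup>2\<close>, since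
  \<open>(1 - C) / a\<^sup>2\<close> tends to \<open>t\<^sup>2 / 2\<close>, the numerator tends to \<open>t\<^sup>2\<close> and the denominator to
  \<open>c\<^sup>2 + t\<^sup>2 > 0\<close>, so the base tends to \<open>t\<^sup>2 / (t\<^sup>2 + c\<^sup>2)\<close>. The power \<open>x powr \<gamma>\<close> with \<open>\<gamma> > 0\<close> is
  continuous on \<open>[0, \<infinity>)\<close>, including at the point \<open>0\<close> reached when \<open>t = 0\<close>.

  On the probabilistic side only the scaling rule for characteristic functions is needed: that of
  \<open>a * X\<close> at \<open>t\<close> is that of \<open>X\<close> at \<open>a * t\<close>.\<close>

lemma SDS_base_eq:
  fixes \<kappa> C :: real
  assumes "(1 - \<kappa>)\<^sup>2 + 2 * \<kappa> * (1 - C) \<noteq> 0"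
  shows "1 - (1 - \<kappa>) * ((C - \<kappa>) / (\<kappa>\<^sup>2 - 2 * \<kappa> * C + 1)) =
           (1 + \<kappa>) * (1 - C) / ((1 - \<kappa>)\<^sup>2 + 2 * \<kappa> * (1 - C))"
proof -
  have "\<kappa>\<^sup>2 - 2 * \<kappa> * C + 1 = (1 - \<kappa>)\<^sup>2 + 2 * \<kappa> * (1 - C)"
    by (simp add: power2_eq_square algebra_simps)
  moreover have "(1 - \<kappa>)\<^sup>2 + 2 * \<kappa> * (1 - C) - (1 - \<kappa>) * (C - \<kappa>) = (1 + \<kappa>) * (1 - C)"
    by (simp add: power2_eq_square algebra_simps)
  ultimately show ?thesis
    using assms by (simp add: diff_divide_eq_iff)
qed

text \<open>By \<open>1 - cos x = 2 * (sin (x / 2))\<^sup>2\<close> the quotient is twice the square of a difference quotient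
  of \<open>\<lambda>a. sin (a * t / 2)\<close> at \<open>0\<close>.\<close>

lemma tendsto_one_minus_cos_over_square:
  fixes t :: real
  shows "((\<lambda>a. (1 - cos (a * t)) / a\<^sup>2) \<longlongrightarrow> t\<^sup>2 / 2) (at 0)"
proof -
  have "((\<lambda>a. sin (a * t / 2)) has_real_derivative t / 2) (at 0)"
    by (auto intro!: derivative_eq_intros)
  then have "((\<lambda>a. sin (a * t / 2) / a) \<longlongrightarrow> t / 2) (at 0)"
    by (simp add: has_field_derivative_iff)
  then have "((\<lambda>a. 2 * (sin (a * t / 2) / a)\<^sup>2) \<longlongrightarrow> 2 * (t / 2)\<^sup>2) (at 0)"
    by (intro tendsto_mult_left tendsto_power)
  moreover have "2 * (sin (a * t / 2) / a)\<^sup>2 = (1 - cos (a * t)) / a\<^sup>2" for a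
    using cos_double_sin[of "a * t / 2"] by (simp add: power_divide)
  moreover have "2 * (t / 2)\<^sup>2 = t\<^sup>2 / 2"
    by (simp add: power_divide)
  ultimately show ?thesis
    by (simp only:)
qed

lemma tendsto_SDS_cf:
  fixes \<gamma> lam c t :: real
  assumes "0 < \<gamma>" and "0 < c"
  shows "((\<lambda>a. SDS_cf \<gamma> lam (1 - a * c) (a * t))
            \<longlongrightarrow> exp (- lam * (t\<^sup>2 / (t\<^sup>2 + c\<^sup>2)) powr \<gamma>)) (at_right 0)"
proof -
  define g where "g a = (1 - cos (a * t)) / a\<^sup>2" for a
  define h where "h a = (2 - a * c) * g a / (c\<^sup>2 + 2 * (1 - a * c) * g a)" for a
  have g: "(g \<longlongrightarrow> t\<^sup>2 / 2) (at_right 0)"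
    unfolding g_def
    by (rule filterlim_mono[OF tendsto_one_minus_cos_over_square order_refl]) (simp add: at_le)
  have pos: "c\<^sup>2 + t\<^sup>2 > 0"
    using \<open>0 < c\<close> by (simp add: add_pos_nonneg)
  have "(h \<longlongrightarrow> (2 - 0 * c) * (t\<^sup>2 / 2) / (c\<^sup>2 + 2 * (1 - 0 * c) * (t\<^sup>2 / 2))) (at_right 0)"
    unfolding h_def using pos by (intro tendsto_intros g) auto
  then have h: "(h \<longlongrightarrow> t\<^sup>2 / (t\<^sup>2 + c\<^sup>2)) (at_right 0)"
    by (simp add: add.commute)
  have small: "\<forall>\<^sub>F a in at_right 0. 0 < a \<and> a < 1 / c"
    using eventually_at_right_real[of 0 "1 / c"] \<open>0 < c\<close> by simp
  have facts: "0 \<le> h a \<and> SDS_cf \<gamma> lam (1 - a * c) (a * t) = exp (- lam * h a powr \<gamma>)"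
    if a: "0 < a \<and> a < 1 / c" for a
  proof -
    have ac: "a * c < 1"
      using a \<open>0 < c\<close> by (simp add: field_simps)
    have "g a \<ge> 0"
      by (simp add: g_def)
    then have D: "c\<^sup>2 + 2 * (1 - a * c) * g a > 0"
      using ac \<open>0 < c\<close> by (intro add_pos_nonneg mult_nonneg_nonneg) auto
    have C: "1 - cos (a * t) = a\<^sup>2 * g a"
      using a by (simp add: g_def)
    have den: "(1 - (1 - a * c))\<^sup>2 + 2 * (1 - a * c) * (1 - cos (a * t)) =
        a\<^sup>2 * (c\<^sup>2 + 2 * (1 - a * c) * g a)"
      unfolding C by (simp add: power2_eq_square algebra_simps)
    then have "(1 - (1 - a * c))\<^sup>2 + 2 * (1 - a * c) * (1 - cos (a * t)) \<noteq> 0"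
      using D a by simp
    note base = SDS_base_eq[OF this]
    have num: "(1 + (1 - a * c)) * (1 - cos (a * t)) = a\<^sup>2 * ((2 - a * c) * g a)"
      unfolding C by (simp add: algebra_simps)
    have "SDS_cf \<gamma> lam (1 - a * c) (a * t) = exp (- lam * h a powr \<gamma>)"
      unfolding SDS_cf_def base unfolding num den h_def using a by simp
    moreover have "0 \<le> h a"
      unfolding h_def using D \<open>g a \<ge> 0\<close> ac by (intro divide_nonneg_pos mult_nonneg_nonneg) auto
    ultimately show ?thesis by blast
  qed
  \<comment> \<open>For \<open>t = 0\<close> the limit of the base is \<open>0\<close>, where continuity of the power needs \<open>\<gamma> > 0\<close> and a
    nonnegative base.\<close>
  have "((\<lambda>a. h a powr \<gamma>) \<longlongrightarrow> (t\<^sup>2 / (t\<^sup>2 + c\<^sup>2)) powr \<gamma>) (at_right 0)"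
  proof (rule tendsto_powr'[OF h tendsto_const])
    have "\<forall>\<^sub>F a in at_right 0. 0 \<le> h a"
      using small by eventually_elim (use facts in blast)
    then show "t\<^sup>2 / (t\<^sup>2 + c\<^sup>2) \<noteq> 0 \<or> 0 < \<gamma> \<and> (\<forall>\<^sub>F a in at_right 0. 0 \<le> h a)"
      using \<open>0 < \<gamma>\<close> by blast
  qed
  then have "((\<lambda>a. exp (- lam * h a powr \<gamma>)) \<longlongrightarrow> exp (- lam * (t\<^sup>2 / (t\<^sup>2 + c\<^sup>2)) powr \<gamma>)) (at_right 0)"
    by (intro tendsto_exp tendsto_mult_left)
  moreover have "\<forall>\<^sub>F a in at_right 0. exp (- lam * h a powr \<gamma>) = SDS_cf \<gamma> lam (1 - a * c) (a * t)"
    using small by eventually_elim (use facts in simp)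
  ultimately show ?thesis
    by (rule Lim_transform_eventually)
qed

lemma scaled_cf_eq_SDS_cf:
  assumes "SDS_random_variable \<gamma> lam \<kappa> M X"
  shows "scaled_cf M X a t = complex_of_real (SDS_cf \<gamma> lam \<kappa> (a * t))"
proof -
  obtain p where X[measurable]: "X \<in> measurable M (count_space UNIV)"
    and p: "is_SDS \<gamma> lam \<kappa> p" "distr M (count_space UNIV) X = measure_pmf p"
    using assms by (auto simp: SDS_random_variable_def)
  have "scaled_cf M X a t = (LINT \<omega>|M. iexp (t * (a * real_of_int (X \<omega>))))"
    unfolding scaled_cf_def char_def by (subst integral_distr) auto
  also have "\<dots> = (LINT \<omega>|M. iexp ((a * t) * real_of_int (X \<omega>)))"
    by (simp add: mult_ac)
  also have "\<dots> = char (distr (distr M (count_space UNIV) X) borel real_of_int) (a * t)"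
    unfolding char_def by (subst integral_distr, simp, simp)+ simp
  also have "\<dots> = complex_of_real (SDS_cf \<gamma> lam \<kappa> (a * t))"
    using p by (simp add: is_SDS_def)
  finally show ?thesis .
qed

theorem theorem5p5:
  fixes \<gamma> lam c :: real
  assumes "0 < \<gamma>" and "\<gamma> \<le> 1" and "0 < lam" and "0 < c"
  shows "(\<forall>(M :: real \<Rightarrow> 'a measure) X.
            (\<forall>a>0. 1 - a * c \<in> {0..<1} \<longrightarrow> SDS_random_variable \<gamma> lam (1 - a * c) (M a) (X a)) \<longrightarrow>
              (\<forall>a>0. 1 - a * c \<in> {0..<1} \<longrightarrow>
                 (\<forall>t. scaled_cf (M a) (X a) a t = complex_of_real (SDS_cf \<gamma> lam (1 - a * c) (a * t)))) \<and>
              (\<forall>t. ((\<lambda>a. scaled_cf (M a) (X a) a t)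
                 \<longlongrightarrow> complex_of_real (exp (- lam * (t\<^sup>2 / (t\<^sup>2 + c\<^sup>2)) powr \<gamma>))) (at_right 0))) \<and>
         (\<forall>t. ((\<lambda>a. SDS_cf \<gamma> lam (1 - a * c) (a * t))
            \<longlongrightarrow> exp (- lam * (t\<^sup>2 / (t\<^sup>2 + c\<^sup>2)) powr \<gamma>)) (at_right 0))"
proof (intro conjI allI impI)
  fix t :: real
  show "((\<lambda>a. SDS_cf \<gamma> lam (1 - a * c) (a * t))
            \<longlongrightarrow> exp (- lam * (t\<^sup>2 / (t\<^sup>2 + c\<^sup>2)) powr \<gamma>)) (at_right 0)"
    using assms by (intro tendsto_SDS_cf)
next
  fix M :: "real \<Rightarrow> 'a measure" and X :: "real \<Rightarrow> 'a \<Rightarrow> int" and a t :: real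
  assume "\<forall>a>0. 1 - a * c \<in> {0..<1} \<longrightarrow> SDS_random_variable \<gamma> lam (1 - a * c) (M a) (X a)"
    and "0 < a" and "1 - a * c \<in> {0..<1}"
  then show "scaled_cf (M a) (X a) a t = complex_of_real (SDS_cf \<gamma> lam (1 - a * c) (a * t))"
    by (intro scaled_cf_eq_SDS_cf) blast
next
  fix M :: "real \<Rightarrow> 'a measure" and X :: "real \<Rightarrow> 'a \<Rightarrow> int" and t :: real
  assume SDS: "\<forall>a>0. 1 - a * c \<in> {0..<1} \<longrightarrow> SDS_random_variable \<gamma> lam (1 - a * c) (M a) (X a)"
  have "\<forall>\<^sub>F a in at_right 0. 0 < a \<and> a < 1 / c"
    using eventually_at_right_real[of 0 "1 / c"] \<open>0 < c\<close> by simp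
  then have "\<forall>\<^sub>F a in at_right 0.
      complex_of_real (SDS_cf \<gamma> lam (1 - a * c) (a * t)) = scaled_cf (M a) (X a) a t"
  proof eventually_elim
    case (elim a)
    then have "1 - a * c \<in> {0..<1}"
      using \<open>0 < c\<close> by (simp add: field_simps)
    then show ?case
      using SDS elim by (intro scaled_cf_eq_SDS_cf[symmetric]) blast
  qed
  moreover have "((\<lambda>a. complex_of_real (SDS_cf \<gamma> lam (1 - a * c) (a * t)))
      \<longlongrightarrow> complex_of_real (exp (- lam * (t\<^sup>2 / (t\<^sup>2 + c\<^sup>2)) powr \<gamma>))) (at_right 0)"
    using assms by (intro tendsto_of_real tendsto_SDS_cf)
  ultimately show "((\<lambda>a. scaled_cf (M a) (X a) a t)
      \<longlongrightarrow> complex_of_real (exp (- lam * (t\<^sup>2 / (t\<^sup>2 + c\<^sup>2)) powr \<gamma>))) (at_right 0)"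
    by (rule Lim_transform_eventually[rotated])
qed

end
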